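(* Let $f:\mathbb{R}^n\to\mathbb{R}\cup\{+\infty\}$ be proper, lower semicontinuous and convex, $A\in\mathbb{R}^{m\times n}$, $b\in\mathbb{R}^m$, and let $X$ be the set of minimizers over $x\in\mathbb{R}^n$ of $f(x)+\frac12\|Ax-b\|^2$. Assume $X\neq\varnothing$, let $x^\star\in X$ and $r=b-Ax^\star$. Then $$\big(\partial f^*(A^\top r)\big)_\infty\cap\ker A=\ker f_\infty\cap\ker A=\mathcal R_f\cap\ker A=(\operatorname{slev}_{x^\star}f)_\infty\cap\ker A.$$
   Context: $f^*$ is the convex conjugate, $\partial$ the convex subdifferential. $f_\infty(d)=\lim_{t\to+\infty}\frac{f(x+td)-f(x)}{t}$ (any $x\in\operatorname{dom}f$) is the recession function and $\ker f_\infty=\{d\in\mathbb{R}^n:f_\infty(d)=0\}$. The recession cone of $f$ is $\mathcal R_f=\{d\in\mathbb{R}^n:f(x+td)\le f(x)\ \forall t>0,\ \forall x\in\operatorname{dom}f\}$. The sublevel set of $f$ through $x_0$ is $\operatorname{slev}_{x_0}f=\{z\in\mathbb{R}^n:f(z)\le f(x_0)\}$. For a nonempty closed convex set $C$, $C_\infty=\{d: x+td\in C\ \ \forall x\in C,\ \forall t>0\}$ is its recession cone. The vector $Ax^\star$, hence $r$, is the same for all $x^\star\in X$. *)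

theory Defs
  imports "HOL-Analysis.Analysis"
begin

definition effective_domain :: "('a \<Rightarrow> ereal) \<Rightarrow> 'a set" where
  "effective_domain f = {x. f x < \<infinity>}"

definition proper_fun :: "('a \<Rightarrow> ereal) \<Rightarrow> bool" where
  "proper_fun f \<longleftrightarrow> (\<forall>x. f x \<noteq> -\<infinity>) \<and> effective_domain f \<noteq> {}"

definition lower_semicontinuous :: "('a::topological_space \<Rightarrow> ereal) \<Rightarrow> bool" where
  "lower_semicontinuous f \<longleftrightarrow> (\<forall>x. f x \<le> Liminf (at x) f)"

text \<open>Only used for functions that omit the value \<open>-\<infinity>\<close>, so that no sum \<open>\<infinity> + (-\<infinity>)\<close>
  occurs; on \<^typ>\<open>ereal\<close>, \<open>0 * \<infinity> = 0\<close>.\<close>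

definition convex_fun :: "('a::real_vector \<Rightarrow> ereal) \<Rightarrow> bool" where
  "convex_fun f \<longleftrightarrow>
    (\<forall>x y. \<forall>u\<ge>0. \<forall>v\<ge>0. u + v = 1 \<longrightarrow>
      f (u *\<^sub>R x + v *\<^sub>R y) \<le> ereal u * f x + ereal v * f y)"

definition conjugate :: "('a::real_inner \<Rightarrow> ereal) \<Rightarrow> 'a \<Rightarrow> ereal" where
  "conjugate f y = (SUP x. ereal (y \<bullet> x) - f x)"

text \<open>Empty at points where the function is not finite.\<close>

definition subdifferential :: "('a::real_inner \<Rightarrow> ereal) \<Rightarrow> 'a \<Rightarrow> 'a set" where
  "subdifferential g x =
    {s. \<bar>g x\<bar> \<noteq> \<infinity> \<and> (\<forall>z. g x + ereal (s \<bullet> (z - x)) \<le> g z)}"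

text \<open>For a proper, lower semicontinuous and convex \<open>f\<close> the limit exists in the extended reals
  and is the same for every base point \<open>x\<close> of the effective domain; the description below is
  meaningful only when this is the case.\<close>

definition recession_fun :: "('a::real_normed_vector \<Rightarrow> ereal) \<Rightarrow> 'a \<Rightarrow> ereal" where
  "recession_fun f d =
    (THE l. \<forall>x\<in>effective_domain f.
      ((\<lambda>t::real. (f (x + t *\<^sub>R d) - f x) / ereal t) \<longlongrightarrow> l) at_top)"

definition recession_cone_fun :: "('a::real_vector \<Rightarrow> ereal) \<Rightarrow> 'a set" where
  "recession_cone_fun f =
    {d. \<forall>t>0. \<forall>x\<in>effective_domain f. f (x + t *\<^sub>R d) \<le> f x}"

definition recession_cone_set :: "'a::real_vector set \<Rightarrow> 'a set" where
  "recession_cone_set C = {d. \<forall>x\<in>C. \<forall>t>0. x + t *\<^sub>R d \<in> C}"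

definition slev :: "'a \<Rightarrow> ('a \<Rightarrow> ereal) \<Rightarrow> 'a set" where
  "slev x0 f = {z. f z \<le> f x0}"

definition ker :: "('a \<Rightarrow> 'b::zero) \<Rightarrow> 'a set" where
  "ker h = {d. h d = 0}"

end

theory Submission
  imports Defs
begin

text \<open>
  Put \<open>y = A\<^sup>T r\<close>. Fermat's rule for the least-squares problem says \<open>y \<in> \<partial>f(x\<^sup>\<star>)\<close>
  (\<open>least_squares_optimality\<close>), and \<open>y \<bullet> d = r \<bullet> A d = 0\<close> for every \<open>d \<in> ker A\<close>. So along the
  directions in \<open>ker A\<close> the supporting affine function of \<open>f\<close> at \<open>x\<^sup>\<star>\<close> is constant, and the
  four sets are four ways to say that \<open>f\<close> does not increase along \<open>d\<close>.

  The link between them is \<open>recession_bound_transfer\<close>: if \<open>f\<close> grows at most with slope \<open>l\<close> along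
  one ray of direction \<open>d\<close>, then it does so, from the value at the base point, along every ray of
  direction \<open>d\<close> that starts in the domain.
  With \<open>l = 0\<close> it identifies the recession cone of \<open>f\<close> with that of the sublevel set through
  any point of the domain. With general \<open>l\<close> it shows that the limit defining \<open>f\<^sub>\<infinity>(d)\<close> does not depend
  on the base point, so that \<open>f\<^sub>\<infinity>(d)\<close> is the supremum of the difference quotients and
  \<open>f\<^sub>\<infinity>(d) \<le> 0\<close> describes the recession cone; on \<open>ker A\<close> the reverse inequality
  \<open>f\<^sub>\<infinity>(d) \<ge> y \<bullet> d = 0\<close> comes from the supporting affine function.

  Finally, \<open>\<partial>f\<^sup>*(y)\<close> is the set where \<open>f\<close> meets that affine function
  (\<open>subdifferential_conjugate_eq\<close>), which is a sublevel set of \<open>f\<close> tilted by \<open>y\<close>. As the tilt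
  is constant along \<open>ker A\<close>, the recession directions of this set in \<open>ker A\<close> are again those
  of \<open>f\<close>.
\<close>

section \<open>Lower semicontinuity and convexity through real upper bounds\<close>

lemma lower_semicontinuous_le_limit:
  fixes f :: "'a::topological_space \<Rightarrow> ereal"
  assumes "lower_semicontinuous f" "F \<noteq> bot"
    and g: "(g \<longlongrightarrow> p) F" and h: "(h \<longlongrightarrow> c) F"
    and le: "eventually (\<lambda>s. f (g s) \<le> ereal (h s)) F"
  shows "f p \<le> ereal c"
proof (rule ccontr)
  assume "\<not> ?thesis"
  then obtain m where m: "ereal c < ereal m" "ereal m < f p"
    using ereal_dense2[of "ereal c" "f p"] by (auto simp: not_le)
  have "f p \<le> Liminf (at p) f"
    using assms(1) by (simp add: lower_semicontinuous_def)
  then have "eventually (\<lambda>z. ereal m < f z) (at p)"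
    using m(2) by (simp add: le_Liminf_iff)
  \<comment> \<open>\<open>Liminf (at p)\<close> ignores \<open>p\<close> itself, but \<open>g\<close> may take the value \<open>p\<close>.\<close>
  then have "eventually (\<lambda>z. ereal m < f z) (nhds p)"
    using m(2) by (auto simp: eventually_at_filter elim: eventually_mono)
  then have "eventually (\<lambda>s. ereal m < f (g s)) F"
    using g by (rule eventually_compose_filterlim)
  moreover have "eventually (\<lambda>s. h s < m) F"
    using order_tendstoD(2)[OF h] m(1) by simp
  ultimately have "eventually (\<lambda>s. False) F"
    using le
  proof eventually_elim
    case (elim s)
    have "ereal m < ereal (h s)" using elim(1,3) by (rule less_le_trans)
    then show ?case using elim(2) by simp
  qed
  then show False using assms(2) by (simp add: trivial_limit_def)
qed

lemma closed_le_continuous: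
  fixes f :: "'a::metric_space \<Rightarrow> ereal" and h :: "'a \<Rightarrow> real"
  assumes "lower_semicontinuous f" "continuous_on UNIV h"
  shows "closed {z. f z \<le> ereal (h z)}"
  unfolding closed_sequential_limits
proof (intro allI impI, elim conjE)
  fix g p assume g: "\<forall>n. g n \<in> {z. f z \<le> ereal (h z)}" "g \<longlonglongrightarrow> p"
  have "(\<lambda>n. h (g n)) \<longlonglongrightarrow> h p"
    using continuous_on_tendsto_compose[OF assms(2) g(2)] by simp
  then show "p \<in> {z. f z \<le> ereal (h z)}"
    using lower_semicontinuous_le_limit[OF assms(1) _ g(2)] g(1) by simp
qed

lemma convex_fun_le:
  assumes "convex_fun f" "u \<ge> 0" "v \<ge> 0" "u + v = 1"
    and "f x \<le> ereal a" "f y \<le> ereal b"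
  shows "f (u *\<^sub>R x + v *\<^sub>R y) \<le> ereal (u * a + v * b)"
proof -
  have "f (u *\<^sub>R x + v *\<^sub>R y) \<le> ereal u * f x + ereal v * f y"
    using assms by (simp add: convex_fun_def)
  also have "\<dots> \<le> ereal u * ereal a + ereal v * ereal b"
    using assms by (intro add_mono ereal_mult_left_mono) auto
  finally show ?thesis by simp
qed

lemma proper_fun_domain_real:
  assumes "proper_fun f" "x \<in> effective_domain f"
  obtains a where "f x = ereal a"
  using assms by (cases "f x") (auto simp: proper_fun_def effective_domain_def)

section \<open>Recession directions\<close>

text \<open>The point \<open>x + t d\<close> is the limit, as \<open>s \<rightarrow> 0\<close>, of the points
  \<open>(1 - s) x + s (x\<^sub>0 + (t / s) d)\<close>, which join \<open>x\<close> to ever farther points of the ray from \<open>x\<^sub>0\<close>;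
  convexity bounds \<open>f\<close> there by \<open>(1 - s) f x + s M + t l\<close>, and lower semicontinuity passes to
  the limit.\<close>

lemma recession_bound_transfer:
  fixes f :: "'a::real_normed_vector \<Rightarrow> ereal"
  assumes "lower_semicontinuous f" "convex_fun f"
    and ray: "\<And>t. t > 0 \<Longrightarrow> f (x0 + t *\<^sub>R d) \<le> ereal (M + t * l)"
    and x: "f x \<le> ereal a" and t: "t > 0"
  shows "f (x + t *\<^sub>R d) \<le> ereal (a + t * l)"
proof (rule lower_semicontinuous_le_limit[OF assms(1)])
  show "((\<lambda>s. (1 - s) *\<^sub>R x + s *\<^sub>R x0 + t *\<^sub>R d) \<longlongrightarrow> x + t *\<^sub>R d) (at_right 0)"
    by (auto intro!: tendsto_eq_intros)
  show "((\<lambda>s. (1 - s) * a + s * M + t * l) \<longlongrightarrow> a + t * l) (at_right 0)"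
    by (auto intro!: tendsto_eq_intros)
  show "eventually (\<lambda>s. f ((1 - s) *\<^sub>R x + s *\<^sub>R x0 + t *\<^sub>R d)
          \<le> ereal ((1 - s) * a + s * M + t * l)) (at_right 0)"
    unfolding eventually_at_right_field
  proof (intro exI[of _ 1] conjI allI impI)
    fix s :: real assume s: "0 < s" "s < 1"
    have "f ((1 - s) *\<^sub>R x + s *\<^sub>R (x0 + (t / s) *\<^sub>R d))
        \<le> ereal ((1 - s) * a + s * (M + (t / s) * l))"
      using s t by (intro convex_fun_le[OF assms(2)] x ray) auto
    then show "f ((1 - s) *\<^sub>R x + s *\<^sub>R x0 + t *\<^sub>R d) \<le> ereal ((1 - s) * a + s * M + t * l)"
      using s by (simp add: algebra_simps)
  qed simp
qed simp

lemma recession_cone_fun_eq_slev: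
  fixes f :: "'a::real_normed_vector \<Rightarrow> ereal"
  assumes "proper_fun f" "lower_semicontinuous f" "convex_fun f"
    and x0: "x0 \<in> effective_domain f"
  shows "recession_cone_fun f = recession_cone_set (slev x0 f)"
proof (intro set_eqI iffI)
  fix d assume d: "d \<in> recession_cone_fun f"
  show "d \<in> recession_cone_set (slev x0 f)"
    unfolding recession_cone_set_def slev_def
  proof (intro CollectI ballI allI impI)
    fix x and t :: real assume "x \<in> {z. f z \<le> f x0}" "t > 0"
    moreover from this have "x \<in> effective_domain f"
      using x0 by (auto simp: effective_domain_def)
    ultimately show "f (x + t *\<^sub>R d) \<le> f x0"
      using d by (auto simp: recession_cone_fun_def intro: order_trans)
  qed
next
  fix d assume d: "d \<in> recession_cone_set (slev x0 f)"
  obtain c where c: "f x0 = ereal c" using proper_fun_domain_real[OF assms(1) x0] .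
  have ray: "f (x0 + t *\<^sub>R d) \<le> ereal (c + t * 0)" if "t > 0" for t
    using d that c by (auto simp: recession_cone_set_def slev_def)
  show "d \<in> recession_cone_fun f"
    unfolding recession_cone_fun_def
  proof (intro CollectI allI ballI impI)
    fix t :: real and x assume t: "t > 0" and x: "x \<in> effective_domain f"
    obtain a where "f x = ereal a" using proper_fun_domain_real[OF assms(1) x] .
    then show "f (x + t *\<^sub>R d) \<le> f x"
      using recession_bound_transfer[OF assms(2,3) ray _ t, of x a] by simp
  qed
qed

section \<open>The recession function as a supremum of difference quotients\<close>

lemma difference_quotient_le_iff:
  assumes "f x = ereal a" "t > 0"
  shows "(f (x + t *\<^sub>R d) - f x) / ereal t \<le> ereal l \<longleftrightarrow> f (x + t *\<^sub>R d) \<le> ereal (a + t * l)"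
  using assms by (cases "f (x + t *\<^sub>R d)") (auto simp: field_simps)

lemma difference_quotient_mono:
  fixes f :: "'a::real_vector \<Rightarrow> ereal"
  assumes "convex_fun f" "f x = ereal a" "0 < s" "s \<le> t"
  shows "(f (x + s *\<^sub>R d) - f x) / ereal s \<le> (f (x + t *\<^sub>R d) - f x) / ereal t"
proof (rule ereal_le_real)
  fix l assume "(f (x + t *\<^sub>R d) - f x) / ereal t \<le> ereal l"
  then have "f (x + t *\<^sub>R d) \<le> ereal (a + t * l)"
    using assms difference_quotient_le_iff[of f x a t d l] by simp
  then have "f ((1 - s / t) *\<^sub>R x + (s / t) *\<^sub>R (x + t *\<^sub>R d))
      \<le> ereal ((1 - s / t) * a + (s / t) * (a + t * l))"
    using assms by (intro convex_fun_le) auto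
  moreover have "(1 - s / t) *\<^sub>R x + (s / t) *\<^sub>R (x + t *\<^sub>R d) = x + s *\<^sub>R d"
    using assms by (simp add: algebra_simps)
  moreover have "(1 - s / t) * a + (s / t) * (a + t * l) = a + s * l"
    using assms by (simp add: field_simps)
  ultimately show "(f (x + s *\<^sub>R d) - f x) / ereal s \<le> ereal l"
    using assms difference_quotient_le_iff[of f x a s d l] by simp
qed

text \<open>The difference quotients increase, so their limit is their supremum, and
  \<open>recession_bound_transfer\<close> makes the supremum at one base point a bound at every other one.\<close>

lemma recession_fun_eq_SUP:
  fixes f :: "'a::real_normed_vector \<Rightarrow> ereal"
  assumes "proper_fun f" "lower_semicontinuous f" "convex_fun f"
    and x0: "x0 \<in> effective_domain f"
  shows "recession_fun f d = (SUP t\<in>{0<..}. (f (x0 + t *\<^sub>R d) - f x0) / ereal t)"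
proof -
  define q where "q x t = (f (x + t *\<^sub>R d) - f x) / ereal t" for x t
  define S where "S x = (SUP t\<in>{0<..}. q x t)" for x
  have lim: "(q x \<longlongrightarrow> S x) at_top" if x: "x \<in> effective_domain f" for x
  proof (rule order_tendstoI)
    obtain a where a: "f x = ereal a" using proper_fun_domain_real[OF assms(1) x] .
    fix c assume "c < S x"
    then obtain s where s: "s > 0" "c < q x s" by (auto simp: S_def less_SUP_iff)
    have "c < q x t" if "t \<ge> s" for t
      using difference_quotient_mono[OF assms(3) a s(1) that, of d] s(2)
      unfolding q_def by (rule less_le_trans[rotated])
    then show "eventually (\<lambda>t. c < q x t) at_top"
      by (auto simp: eventually_at_top_linorder)
  next
    fix c assume "S x < c"
    moreover have "q x t \<le> S x" if "t > 0" for t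
      unfolding S_def using that by (intro SUP_upper) auto
    ultimately show "eventually (\<lambda>t. q x t < c) at_top"
      by (intro eventually_mono[OF eventually_gt_at_top[of 0]]) (rule le_less_trans)
  qed
  have le: "S x \<le> S x'" if x: "x \<in> effective_domain f" and x': "x' \<in> effective_domain f" for x x'
  proof (rule ereal_le_real)
    fix l assume l: "S x' \<le> ereal l"
    obtain a where a: "f x = ereal a" using proper_fun_domain_real[OF assms(1) x] .
    obtain a' where a': "f x' = ereal a'" using proper_fun_domain_real[OF assms(1) x'] .
    have ray: "f (x' + t *\<^sub>R d) \<le> ereal (a' + t * l)" if "t > 0" for t
    proof -
      have "q x' t \<le> ereal l"
        using l that by (auto simp: S_def SUP_le_iff)
      then show ?thesis
        using difference_quotient_le_iff[of f x' a' t d l] a' that by (simp add: q_def)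
    qed
    have "q x t \<le> ereal l" if "t > 0" for t
      using recession_bound_transfer[OF assms(2,3) ray _ that, of x a] a that
        difference_quotient_le_iff[of f x a t d l] by (simp add: q_def)
    then show "S x \<le> ereal l"
      unfolding S_def by (intro SUP_least) simp
  qed
  have "recession_fun f d = S x0"
    unfolding recession_fun_def
  proof (rule the_equality)
    show "\<forall>x\<in>effective_domain f. ((\<lambda>t. (f (x + t *\<^sub>R d) - f x) / ereal t) \<longlongrightarrow> S x0) at_top"
    proof
      fix x assume x: "x \<in> effective_domain f"
      then have "S x = S x0" using le x0 by (intro antisym) auto
      then show "((\<lambda>t. (f (x + t *\<^sub>R d) - f x) / ereal t) \<longlongrightarrow> S x0) at_top"
        using lim[OF x] by (simp add: q_def[abs_def])
    qed
  next
    fix l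
    assume "\<forall>x\<in>effective_domain f. ((\<lambda>t. (f (x + t *\<^sub>R d) - f x) / ereal t) \<longlongrightarrow> l) at_top"
    then have "(q x0 \<longlongrightarrow> l) at_top" using x0 by (simp add: q_def[abs_def])
    then show "l = S x0" using lim[OF x0] by (intro tendsto_unique) auto
  qed
  then show ?thesis by (simp add: S_def q_def)
qed

lemma recession_fun_le_0_iff:
  fixes f :: "'a::real_normed_vector \<Rightarrow> ereal"
  assumes "proper_fun f" "lower_semicontinuous f" "convex_fun f"
  shows "recession_fun f d \<le> 0 \<longleftrightarrow> d \<in> recession_cone_fun f"
proof -
  have iff: "recession_fun f d \<le> 0 \<longleftrightarrow> (\<forall>t>0. f (x + t *\<^sub>R d) \<le> f x)"
    if x: "x \<in> effective_domain f" for x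
  proof -
    obtain a where a: "f x = ereal a" using proper_fun_domain_real[OF assms(1) x] .
    have "recession_fun f d \<le> 0 \<longleftrightarrow> (\<forall>t>0. (f (x + t *\<^sub>R d) - f x) / ereal t \<le> ereal 0)"
      by (auto simp: recession_fun_eq_SUP[OF assms x] SUP_le_iff zero_ereal_def)
    then show ?thesis
      using difference_quotient_le_iff[of f x a _ d 0] a by simp
  qed
  obtain x0 where "x0 \<in> effective_domain f"
    using assms(1) by (auto simp: proper_fun_def)
  then show ?thesis
    using iff by (auto simp: recession_cone_fun_def)
qed

lemma recession_fun_ge_subgradient:
  fixes f :: "'a::real_inner \<Rightarrow> ereal"
  assumes "proper_fun f" "lower_semicontinuous f" "convex_fun f"
    and y: "y \<in> subdifferential f x"
  shows "ereal (y \<bullet> d) \<le> recession_fun f d"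
proof -
  obtain a where a: "f x = ereal a"
    using y by (auto simp: subdifferential_def)
  then have x: "x \<in> effective_domain f" by (simp add: effective_domain_def)
  have "ereal a + ereal (y \<bullet> d) \<le> f (x + 1 *\<^sub>R d)"
    using y a by (auto simp: subdifferential_def dest: spec[of _ "x + d"])
  then have "ereal (y \<bullet> d) \<le> (f (x + 1 *\<^sub>R d) - f x) / ereal 1"
    using a by (cases "f (x + d)") auto
  also have "\<dots> \<le> recession_fun f d"
    unfolding recession_fun_eq_SUP[OF assms(1-3) x] by (rule SUP_upper) simp
  finally show ?thesis .
qed

section \<open>Subgradients of the conjugate\<close>

text \<open>This is the equivalence of \<open>s \<in> \<partial>f\<^sup>*(y)\<close> and \<open>y \<in> \<partial>f(s)\<close>, given one point \<open>x\<close> with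
  \<open>y \<in> \<partial>f(x)\<close>. That point permits a separation in the space itself instead of in the epigraph's
  space: if \<open>f\<close> exceeds the supporting affine function \<open>h\<close> at \<open>s\<close> by more than \<open>e > 0\<close>, a
  hyperplane strictly separates \<open>s\<close> from the closed convex set where \<open>f \<le> h + e\<close>. As \<open>f = h\<close>
  at \<open>x\<close>, convexity forces \<open>f - h\<close> to grow linearly beyond the hyperplane, so that \<open>y\<close> can be
  tilted to a slope whose conjugate value violates the subgradient inequality at \<open>s\<close>.\<close>

lemma subdifferential_conjugate_eq:
  fixes f :: "'a::euclidean_space \<Rightarrow> ereal"
  assumes "lower_semicontinuous f" "convex_fun f"
    and y: "y \<in> subdifferential f x"
  shows "subdifferential (conjugate f) y = {s. f s \<le> f x + ereal (y \<bullet> (s - x))}"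
proof -
  obtain a where a: "f x = ereal a"
    using y by (auto simp: subdifferential_def)
  define h where "h z = a + y \<bullet> (z - x)" for z
  have minorant: "ereal (h z) \<le> f z" for z
    using y a by (simp add: subdifferential_def h_def)
  have conj_ge: "ereal (z \<bullet> s) - f s \<le> conjugate f z" for z s
    unfolding conjugate_def by (rule SUP_upper) simp
  have "conjugate f y \<le> ereal (y \<bullet> x - a)"
    unfolding conjugate_def
  proof (rule SUP_least)
    fix z show "ereal (y \<bullet> z) - f z \<le> ereal (y \<bullet> x - a)"
      using minorant[of z] by (cases "f z") (auto simp: h_def inner_diff_right)
  qed
  then have conj_y: "conjugate f y = ereal (y \<bullet> x - a)"
    using conj_ge[of y x] a by (intro antisym) auto
  have "s \<in> subdifferential (conjugate f) y" if s: "f s \<le> ereal (h s)" for s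
    unfolding subdifferential_def
  proof (intro CollectI conjI allI)
    show "\<bar>conjugate f y\<bar> \<noteq> \<infinity>" by (simp add: conj_y)
    fix z
    have "conjugate f y + ereal (s \<bullet> (z - y)) \<le> ereal (z \<bullet> s) - f s"
      using s minorant[of s] by (cases "f s")
        (auto simp: conj_y h_def inner_diff_right inner_commute)
    also have "\<dots> \<le> conjugate f z" by (rule conj_ge)
    finally show "conjugate f y + ereal (s \<bullet> (z - y)) \<le> conjugate f z" .
  qed
  moreover have "f s \<le> ereal (h s)" if s: "s \<in> subdifferential (conjugate f) y" for s
  proof (rule ccontr)
    assume "\<not> f s \<le> ereal (h s)"
    then obtain m where m: "h s < m" "ereal m < f s"
      using ereal_dense2[of "ereal (h s)" "f s"] by (auto simp: not_le)
    define e where "e = m - h s"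
    have e: "e > 0" "\<not> f s \<le> ereal (h s + e)"
      using m by (auto simp: e_def not_le)
    let ?C = "{z. f z \<le> ereal (h z + e)}"
    have h_affine: "h (u *\<^sub>R p + v *\<^sub>R q) = u * h p + v * h q" if "u + v = 1" for u v p q
    proof -
      have v: "v = 1 - u" using that by simp
      show ?thesis unfolding v by (simp add: h_def algebra_simps inner_add_right inner_diff_right)
    qed
    have "closed ?C"
      by (rule closed_le_continuous[OF assms(1)]) (auto simp: h_def intro!: continuous_intros)
    moreover have "convex ?C"
    proof (rule convexI)
      fix p q and u v :: real
      assume "p \<in> ?C" "q \<in> ?C" and uv: "0 \<le> u" "0 \<le> v" "u + v = 1"
      then have "f (u *\<^sub>R p + v *\<^sub>R q) \<le> ereal (u * (h p + e) + v * (h q + e))"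
        by (intro convex_fun_le[OF assms(2)]) auto
      also have "u * (h p + e) + v * (h q + e) = u * h p + v * h q + (u + v) * e"
        by (simp add: algebra_simps)
      finally show "u *\<^sub>R p + v *\<^sub>R q \<in> ?C"
        using uv by (simp add: h_affine)
    qed
    ultimately obtain w \<beta> where w: "w \<bullet> s < \<beta>" "\<And>z. z \<in> ?C \<Longrightarrow> \<beta> < w \<bullet> z"
      using separating_hyperplane_closed_point[of ?C s] e(2) by auto
    have wx: "\<beta> < w \<bullet> x" using w(2) a e(1) by (simp add: h_def)
    define k where "k = e / (w \<bullet> x - \<beta>)"
    have k: "k > 0" using wx e(1) by (simp add: k_def)
    have growth: "ereal (h z + k * (\<beta> - w \<bullet> z)) \<le> f z" for z
    proof (cases "w \<bullet> z \<ge> \<beta>")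
      case True
      then have "h z + k * (\<beta> - w \<bullet> z) \<le> h z"
        using k by (simp add: mult_nonneg_nonpos)
      then show ?thesis using minorant[of z] by (meson ereal_less_eq(3) order_trans)
    next
      case False
      \<comment> \<open>\<open>p\<close> is the point of the segment from \<open>x\<close> to \<open>z\<close> on the separating hyperplane.\<close>
      define \<mu> where "\<mu> = (w \<bullet> x - \<beta>) / (w \<bullet> x - w \<bullet> z)"
      define p where "p = (1 - \<mu>) *\<^sub>R x + \<mu> *\<^sub>R z"
      have \<mu>: "0 < \<mu>" "\<mu> < 1" using False wx by (auto simp: \<mu>_def)
      have "\<mu> * (w \<bullet> x - w \<bullet> z) = w \<bullet> x - \<beta>" using False wx by (simp add: \<mu>_def)
      then have "w \<bullet> p = \<beta>"
        by (simp add: p_def inner_add_right algebra_simps)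
      then have "p \<notin> ?C" using w(2)[of p] by auto
      have \<mu>k: "\<mu> * k * (\<beta> - w \<bullet> z) \<le> e"
      proof -
        have "\<mu> * k = e / (w \<bullet> x - w \<bullet> z)" using wx by (simp add: \<mu>_def k_def)
        then have "\<mu> * k * (\<beta> - w \<bullet> z) = e * ((\<beta> - w \<bullet> z) / (w \<bullet> x - w \<bullet> z))" by simp
        also have "\<dots> \<le> e * 1"
          using False wx e(1) by (intro mult_left_mono) auto
        finally show ?thesis by simp
      qed
      show ?thesis
      proof (rule ccontr)
        assume "\<not> ?thesis"
        then have "f p \<le> ereal ((1 - \<mu>) * a + \<mu> * (h z + k * (\<beta> - w \<bullet> z)))"
          unfolding p_def using \<mu> a by (intro convex_fun_le[OF assms(2)]) auto
        also have "(1 - \<mu>) * a + \<mu> * (h z + k * (\<beta> - w \<bullet> z)) = h p + \<mu> * k * (\<beta> - w \<bullet> z)"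
          using h_affine[of "1 - \<mu>" \<mu> x z] by (simp add: p_def h_def algebra_simps)
        also have "ereal \<dots> \<le> ereal (h p + e)" using \<mu>k by simp
        finally show False using \<open>p \<notin> ?C\<close> by simp
      qed
    qed
    have "conjugate f (y - k *\<^sub>R w) \<le> ereal (y \<bullet> x - a - k * \<beta>)"
      unfolding conjugate_def
    proof (rule SUP_least)
      fix z show "ereal ((y - k *\<^sub>R w) \<bullet> z) - f z \<le> ereal (y \<bullet> x - a - k * \<beta>)"
        using growth[of z]
        by (cases "f z") (auto simp: h_def inner_diff_right inner_diff_left algebra_simps)
    qed
    moreover have "conjugate f y + ereal (s \<bullet> ((y - k *\<^sub>R w) - y)) \<le> conjugate f (y - k *\<^sub>R w)"
      using s by (simp only: subdifferential_def mem_Collect_eq)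
    ultimately have "conjugate f y + ereal (s \<bullet> ((y - k *\<^sub>R w) - y)) \<le> ereal (y \<bullet> x - a - k * \<beta>)"
      by (rule order_trans[rotated])
    then have "k * \<beta> \<le> k * (w \<bullet> s)"
      by (simp add: conj_y inner_commute)
    then show False using k w(1) by simp
  qed
  ultimately show ?thesis using a by (auto simp: h_def)
qed

text \<open>Along a direction \<open>d\<close> orthogonal to \<open>y\<close> the affine function supporting \<open>f\<close> at \<open>x\<close> is
  constant, so that moving along \<open>d\<close> inside \<open>\<partial>f\<^sup>*(y)\<close>, where \<open>f\<close> equals that function,
  means not increasing \<open>f\<close>.\<close>

lemma recession_cone_subdifferential_conjugate_iff:
  fixes f :: "'a::euclidean_space \<Rightarrow> ereal"
  assumes "proper_fun f" "lower_semicontinuous f" "convex_fun f"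
    and y: "y \<in> subdifferential f x" and orth: "y \<bullet> d = 0"
  shows "d \<in> recession_cone_set (subdifferential (conjugate f) y) \<longleftrightarrow> d \<in> recession_cone_fun f"
proof -
  obtain a where a: "f x = ereal a"
    using y by (auto simp: subdifferential_def)
  then have x: "x \<in> effective_domain f" by (simp add: effective_domain_def)
  note eq = subdifferential_conjugate_eq[OF assms(2,3) y]
  have x_mem: "x \<in> subdifferential (conjugate f) y" by (simp add: eq a)
  have tilt: "y \<bullet> (z + t *\<^sub>R d - x) = y \<bullet> (z - x)" for z t
    using orth by (simp add: inner_diff_right inner_add_right)
  show ?thesis
  proof
    assume d: "d \<in> recession_cone_set (subdifferential (conjugate f) y)"
    have "f (x + t *\<^sub>R d) \<le> f x" if "t > 0" for t
    proof -
      have "x + t *\<^sub>R d \<in> subdifferential (conjugate f) y"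
        using d that x_mem by (simp add: recession_cone_set_def)
      then show ?thesis unfolding eq mem_Collect_eq tilt using a by simp
    qed
    then have "recession_fun f d \<le> 0"
      unfolding recession_fun_eq_SUP[OF assms(1-3) x]
      using difference_quotient_le_iff[of f x a _ d 0] a
      by (intro SUP_least) (simp add: zero_ereal_def)
    then show "d \<in> recession_cone_fun f"
      by (simp add: recession_fun_le_0_iff[OF assms(1-3)])
  next
    assume d: "d \<in> recession_cone_fun f"
    show "d \<in> recession_cone_set (subdifferential (conjugate f) y)"
      unfolding recession_cone_set_def
    proof (intro CollectI ballI allI impI)
      fix z and t :: real assume "z \<in> subdifferential (conjugate f) y" and t: "t > 0"
      then have z: "f z \<le> f x + ereal (y \<bullet> (z - x))" by (simp add: eq)
      then have "z \<in> effective_domain f"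
        using a by (auto simp: effective_domain_def)
      then have "f (z + t *\<^sub>R d) \<le> f z"
        using d t by (simp add: recession_cone_fun_def)
      then show "z + t *\<^sub>R d \<in> subdifferential (conjugate f) y"
        unfolding eq mem_Collect_eq tilt using z by (rule order_trans)
    qed
  qed
qed

section \<open>The least-squares problem\<close>

text \<open>Moving from a minimizer \<open>x\<close> towards \<open>z\<close> by a fraction \<open>t\<close> changes the quadratic term by
  \<open>-t r \<bullet> A (z - x)\<close>, where \<open>r = b - A x\<close>, up to order \<open>t\<^sup>2\<close>, and \<open>f\<close> by at most
  \<open>t (f z - f x)\<close>; divide by \<open>t\<close> and let \<open>t \<rightarrow> 0\<close>.\<close>

lemma least_squares_optimality:
  fixes f :: "real ^ 'n \<Rightarrow> ereal" and A :: "real ^ 'n ^ 'm"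
  assumes "proper_fun f" "convex_fun f"
    and min: "is_arg_min (\<lambda>x. f x + ereal (1 / 2 * (norm (A *v x - b))\<^sup>2)) (\<lambda>_. True) x"
  shows "transpose A *v (b - A *v x) \<in> subdifferential f x"
proof -
  have le: "f x + ereal (1 / 2 * (norm (A *v x - b))\<^sup>2)
      \<le> f z + ereal (1 / 2 * (norm (A *v z - b))\<^sup>2)" for z
    using min by (auto simp: is_arg_min_def not_less)
  obtain x0 where "x0 \<in> effective_domain f"
    using assms(1) by (auto simp: proper_fun_def)
  then have "f x \<noteq> \<infinity>"
    using le[of x0] by (auto simp: effective_domain_def)
  then have "x \<in> effective_domain f" by (simp add: effective_domain_def)
  from proper_fun_domain_real[OF assms(1) this] obtain a where a: "f x = ereal a" .
  define r where "r = b - A *v x"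
  have key: "a + (transpose A *v r) \<bullet> (z - x) \<le> c" if c: "f z = ereal c" for z c
  proof -
    define v where "v = A *v (z - x)"
    have ineq: "r \<bullet> v \<le> c - a + t * (1 / 2 * (norm v)\<^sup>2)" if t: "0 < t" "t < 1" for t
    proof -
      define p where "p = (1 - t) *\<^sub>R x + t *\<^sub>R z"
      have "f p \<le> ereal ((1 - t) * a + t * c)"
        unfolding p_def using t a c by (intro convex_fun_le[OF assms(2)]) auto
      then have "f p + ereal (1 / 2 * (norm (A *v p - b))\<^sup>2)
          \<le> ereal ((1 - t) * a + t * c) + ereal (1 / 2 * (norm (A *v p - b))\<^sup>2)"
        by (rule add_right_mono)
      with le[of p] have "ereal a + ereal (1 / 2 * (norm (A *v x - b))\<^sup>2)
          \<le> ereal ((1 - t) * a + t * c) + ereal (1 / 2 * (norm (A *v p - b))\<^sup>2)"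
        unfolding a by (rule order_trans)
      then have 1: "a + 1 / 2 * (norm (A *v x - b))\<^sup>2
          \<le> (1 - t) * a + t * c + 1 / 2 * (norm (A *v p - b))\<^sup>2"
        by simp
      have "p = x + t *\<^sub>R (z - x)" by (simp add: p_def algebra_simps)
      then have eq: "A *v p - b = t *\<^sub>R v - r"
        by (simp add: v_def r_def matrix_vector_right_distrib matrix_vector_mult_scaleR)
      have 2: "(norm (A *v p - b))\<^sup>2 = t\<^sup>2 * (norm v)\<^sup>2 - 2 * t * (r \<bullet> v) + (norm r)\<^sup>2"
        unfolding eq power2_norm_eq_inner
        by (simp add: inner_diff_left inner_diff_right inner_commute power2_eq_square algebra_simps)
      have 3: "norm (A *v x - b) = norm r" by (simp add: r_def norm_minus_commute)
      have "t * (r \<bullet> v) \<le> t * (c - a + t * (1 / 2 * (norm v)\<^sup>2))"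
        using 1 unfolding 2 3 by (simp add: algebra_simps power2_eq_square)
      then show ?thesis using t by simp
    qed
    have "r \<bullet> v \<le> c - a"
    proof (rule tendsto_lowerbound)
      show "((\<lambda>t. c - a + t * (1 / 2 * (norm v)\<^sup>2)) \<longlongrightarrow> c - a) (at_right 0)"
        by (auto intro!: tendsto_eq_intros)
      show "eventually (\<lambda>t. r \<bullet> v \<le> c - a + t * (1 / 2 * (norm v)\<^sup>2)) (at_right 0)"
        unfolding eventually_at_right_field using ineq by (intro exI[of _ 1]) auto
    qed simp
    then show ?thesis
      by (simp add: v_def dot_lmul_matrix[symmetric] vector_transpose_matrix
          transpose_matrix_vector)
  qed
  show ?thesis
    unfolding subdifferential_def r_def[symmetric]
  proof (intro CollectI conjI allI)
    fix z show "f x + ereal ((transpose A *v r) \<bullet> (z - x)) \<le> f z"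
      using key[of z] assms(1) a by (cases "f z") (auto simp: proper_fun_def)
  qed (simp add: a)
qed

theorem theorem2p16:
  fixes f :: "real ^ 'n \<Rightarrow> ereal"
    and A :: "real ^ 'n ^ 'm"
    and b r :: "real ^ 'm"
    and X :: "(real ^ 'n) set"
    and xstar :: "real ^ 'n"
  assumes "proper_fun f"
    and "lower_semicontinuous f"
    and "convex_fun f"
    and "X = {x. is_arg_min (\<lambda>x. f x + ereal (1 / 2 * (norm (A *v x - b))\<^sup>2)) (\<lambda>_. True) x}"
    and "X \<noteq> {}"
    and "xstar \<in> X"
    and "r = b - A *v xstar"
  shows "recession_cone_set (subdifferential (conjugate f) (transpose A *v r)) \<inter> ker ((*v) A)
           = ker (recession_fun f) \<inter> ker ((*v) A)
       \<and> ker (recession_fun f) \<inter> ker ((*v) A) = recession_cone_fun f \<inter> ker ((*v) A)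
       \<and> recession_cone_fun f \<inter> ker ((*v) A) = recession_cone_set (slev xstar f) \<inter> ker ((*v) A)"
proof -
  have min: "is_arg_min (\<lambda>x. f x + ereal (1 / 2 * (norm (A *v x - b))\<^sup>2)) (\<lambda>_. True) xstar"
    using assms(4,6) by simp
  define y where "y = transpose A *v r"
  have y: "y \<in> subdifferential f xstar"
    unfolding y_def assms(7) by (rule least_squares_optimality[OF assms(1,3) min])
  then have dom: "xstar \<in> effective_domain f"
    by (auto simp: subdifferential_def effective_domain_def)
  have orth: "y \<bullet> d = 0" if "d \<in> ker ((*v) A)" for d
  proof -
    have "y \<bullet> d = r \<bullet> (A *v d)"
      by (simp add: y_def dot_lmul_matrix[symmetric] transpose_matrix_vector)
    then show ?thesis using that by (simp add: ker_def)
  qed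
  have "recession_cone_set (subdifferential (conjugate f) y) \<inter> ker ((*v) A)
      = recession_cone_fun f \<inter> ker ((*v) A)"
    using recession_cone_subdifferential_conjugate_iff[OF assms(1-3) y] orth by blast
  moreover have "ker (recession_fun f) \<inter> ker ((*v) A) = recession_cone_fun f \<inter> ker ((*v) A)"
  proof -
    have "recession_fun f d = 0 \<longleftrightarrow> d \<in> recession_cone_fun f" if "d \<in> ker ((*v) A)" for d
    proof -
      have "0 \<le> recession_fun f d"
        using recession_fun_ge_subgradient[OF assms(1-3) y, of d] orth[OF that]
        by (simp add: zero_ereal_def)
      then show ?thesis
        using recession_fun_le_0_iff[OF assms(1-3), of d] by auto
    qed
    then show ?thesis by (auto simp: ker_def)
  qed
  moreover have "recession_cone_fun f = recession_cone_set (slev xstar f)"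
    by (rule recession_cone_fun_eq_slev[OF assms(1-3) dom])
  ultimately show ?thesis by (simp add: y_def)
qed

end
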